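(* Consider the RDAG model on a coloured DAG $(\mathcal{G},c)$ where the colouring $c$ is compatible and $A(\mathcal{G},c)$ is a group. Set $A:=A(\mathcal{G},c)_{\mathrm{SL}}$ and let $Y\in\mathbb{R}^{m\times n}$ be polystable under $A$. Given an MLE $\lambda a^{\mathsf T}a$ given $Y$, where $a\in A$ is such that $\|aY\|>0$ is minimal in $A\cdot Y$ and $\lambda>0$ is the unique global minimiser of $\mathbb{R}_{>0}\to\mathbb{R}$, $x\mapsto\frac{x}{n}\|aY\|^2-m\log(x)$, the map $$\varphi: A_Y\to\{\text{MLEs given }Y\},\qquad g\mapsto\lambda\, g^{\mathsf T}a^{\mathsf T}a\,g$$ is a bijection.
   Context: $\mathcal{G}=(I,E)$ is a directed acyclic graph (DAG) with vertex set $I=[m]=\{1,\dots,m\}$ and edge set $E$ (no loops, no multiple edges); $j\to i$ denotes an edge from $j$ to $i$. Vertices are ordered so that $j\to i$ implies $j>i$. A coloured DAG $(\mathcal{G},c)$ is a DAG with a map $c: I\cup E\to \mathcal{C}$ to a set of colours; $c(i)$ (also written $c(ii)$) is the colour of vertex $i$ and $c(ij)$ is the colour of the edge $j\to i$. The colouring $c$ is compatible if (i) vertex colours and edge colours are disjoint, and (ii) whenever edges $j\to i$ and $l\to k$ satisfy $c(ij)=c(kl)$, then $c(i)=c(k)$. The RDAG model on $(\mathcal{G},c)$ is the set of all matrices $\Psi=(\mathrm{id}-\Lambda)^{\mathsf T}\Omega^{-1}(\mathrm{id}-\Lambda)$, where $\Lambda\in\mathbb{R}^{m\times m}$ satisfies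 $\lambda_{ij}=0$ unless $j\to i$ in $\mathcal{G}$ and $\lambda_{ij}=\lambda_{kl}$ whenever edges $j\to i$ and $l\to k$ have the same colour, and $\Omega\in\mathbb{R}^{m\times m}$ is diagonal with positive diagonal entries satisfying $\omega_{ii}=\omega_{jj}$ whenever vertices $i,j$ have the same colour. $A(\mathcal{G},c)$ is the set of real invertible $m\times m$ matrices $a$ with $a_{ij}=0$ for $i\ne j$ with $j\not\to i$ in $\mathcal{G}$, and $a_{ij}=a_{kl}$ whenever $c(ij)=c(kl)$ (for vertices and edges). $A(\mathcal{G},c)_{\mathrm{SL}}=\{a\in A(\mathcal{G},c)\mid\det(a)=1\}$. For a set $A$ of real invertible $m\times m$ matrices, $A\cdot Y=\{aY\mid a\in A\}$ and $A_Y=\{a\in A\mid aY=Y\}$; $Y$ is polystable under $A$ if $Y\ne0$ and $A\cdot Y$ is Euclidean closed. Norms are Frobenius norms. For $Y\in\mathbb{R}^{m\times n}$ ($n\ge1$), the log-likelihood is $\ell_Y(\Psi)=\log\det(\Psi)-\mathrm{tr}(\Psi S_Y)$ with $S_Y=\frac1n YY^{\mathsf T}$; an MLE given $Y$ is a maximiser of $\ell_Y$ over the model. *)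

theory Defs
  imports "HOL-Analysis.Analysis" "HOL-Algebra.Group"
begin

text \<open>
  The vertex set is the whole index type \<open>'m::{finite,wellorder}\<close>, playing the role of
  $\{1,\dots,m\}$ with its usual order. A pair \<open>(j, i) \<in> E\<close> is the edge $j \to i$.
\<close>

definition ordered_dag :: "('m::{finite,wellorder} \<times> 'm) set \<Rightarrow> bool" where
  "ordered_dag E \<longleftrightarrow> acyclic E \<and> (\<forall>j i. (j, i) \<in> E \<longrightarrow> j > i)"

text \<open>
  A colouring is a function of two indices: \<open>c i i\<close> is the colour of the vertex \<open>i\<close> and, for
  \<open>(j, i) \<in> E\<close>, \<open>c i j\<close> is the colour of the edge $j \to i$ (head first, to match the matrix
  entry at row \<open>i\<close>, column \<open>j\<close>). All other values of \<open>c\<close> are irrelevant.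
\<close>

definition compatible :: "('m \<times> 'm) set \<Rightarrow> ('m \<Rightarrow> 'm \<Rightarrow> 'c) \<Rightarrow> bool" where
  "compatible E c \<longleftrightarrow>
     {c i i |i. True} \<inter> {c i j |i j. (j, i) \<in> E} = {} \<and>
     (\<forall>i j k l. (j, i) \<in> E \<longrightarrow> (l, k) \<in> E \<longrightarrow> c i j = c k l \<longrightarrow> c i i = c k k)"

definition RDAG_model ::
    "('m \<times> 'm) set \<Rightarrow> ('m \<Rightarrow> 'm \<Rightarrow> 'c) \<Rightarrow> (real^'m^'m) set" where
  "RDAG_model E c =
     {transpose (mat 1 - \<Lambda>) ** matrix_inv \<Omega> ** (mat 1 - \<Lambda>) |\<Lambda> \<Omega>.
        (\<forall>i j. (j, i) \<notin> E \<longrightarrow> \<Lambda> $ i $ j = 0) \<and>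
        (\<forall>i j k l. (j, i) \<in> E \<longrightarrow> (l, k) \<in> E \<longrightarrow> c i j = c k l \<longrightarrow> \<Lambda> $ i $ j = \<Lambda> $ k $ l) \<and>
        (\<forall>i j. i \<noteq> j \<longrightarrow> \<Omega> $ i $ j = 0) \<and>
        (\<forall>i. \<Omega> $ i $ i > 0) \<and>
        (\<forall>i j. c i i = c j j \<longrightarrow> \<Omega> $ i $ i = \<Omega> $ j $ j)}"

definition RDAG_A ::
    "('m \<times> 'm) set \<Rightarrow> ('m \<Rightarrow> 'm \<Rightarrow> 'c) \<Rightarrow> (real^'m^'m) set" where
  "RDAG_A E c =
     {a. invertible a \<and>
         (\<forall>i j. i \<noteq> j \<longrightarrow> (j, i) \<notin> E \<longrightarrow> a $ i $ j = 0) \<and>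
         (\<forall>i j k l. i = j \<or> (j, i) \<in> E \<longrightarrow> k = l \<or> (l, k) \<in> E \<longrightarrow> c i j = c k l \<longrightarrow>
            a $ i $ j = a $ k $ l)}"

definition RDAG_A_SL ::
    "('m \<times> 'm) set \<Rightarrow> ('m \<Rightarrow> 'm \<Rightarrow> 'c) \<Rightarrow> (real^'m^'m) set" where
  "RDAG_A_SL E c = {a \<in> RDAG_A E c. det a = 1}"

definition matrix_group :: "(real^'m^'m) set \<Rightarrow> bool" where
  "matrix_group A \<longleftrightarrow> group \<lparr>carrier = A, mult = (**), one = mat 1\<rparr>"

definition mat_orbit :: "(real^'m^'m) set \<Rightarrow> real^'n^'m \<Rightarrow> (real^'n^'m) set" where
  "mat_orbit A Y = {a ** Y |a. a \<in> A}"

definition mat_stabilizer :: "(real^'m^'m) set \<Rightarrow> real^'n^'m \<Rightarrow> (real^'m^'m) set" where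
  "mat_stabilizer A Y = {a \<in> A. a ** Y = Y}"

definition polystable :: "(real^'m^'m) set \<Rightarrow> real^'n^'m \<Rightarrow> bool" where
  "polystable A Y \<longleftrightarrow> Y \<noteq> 0 \<and> closed (mat_orbit A Y)"

text \<open>A sample is a matrix \<open>Y :: real^'n^'m\<close> with $m$ rows and $n$ columns.\<close>

definition sample_cov :: "real^'n^'m \<Rightarrow> real^'m^'m" where
  "sample_cov Y = (1 / real CARD('n)) *\<^sub>R (Y ** transpose Y)"

definition log_likelihood :: "real^'n^'m \<Rightarrow> real^'m^'m \<Rightarrow> real" where
  "log_likelihood Y \<Psi> = ln (det \<Psi>) - trace (\<Psi> ** sample_cov Y)"

definition MLEs :: "(real^'m^'m) set \<Rightarrow> real^'n^'m \<Rightarrow> (real^'m^'m) set" where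
  "MLEs M Y = {\<Psi>. is_arg_max (log_likelihood Y) (\<lambda>\<Psi>. \<Psi> \<in> M) \<Psi>}"

text \<open>
  The library's \<open>norm\<close> on \<open>real^'n^'m\<close> is the Euclidean norm of the vector of Euclidean row norms,
  i.e. the Frobenius norm, and it induces the Euclidean topology.
\<close>

end

theory Submission imports Defs begin

text \<open>
  Write \<open>A\<close> for the set \<open>RDAG_A E c\<close>. Compatibility of the colouring makes the model equal to
  \<open>{b\<^sup>T b | b \<in> A}\<close>: the Cholesky-type factor of \<open>\<Psi>\<close> is \<open>\<Omega>\<^bsup>-1/2\<^esup> (1 - \<Lambda>)\<close>. In terms of the factor the
  log-likelihood is \<open>ln (det b)\<^sup>2 - \<parallel>b Y\<parallel>\<^sup>2 / n\<close>, and since \<open>b\<close> is upper triangular the first summand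
  is the sum of the \<open>ln b\<^sub>i\<^sub>i\<^sup>2\<close>. The conditions defining \<open>A\<close>, apart from invertibility, are linear,
  so on the matrices of \<open>A\<close> with a given sign pattern on the diagonal the log-likelihood is a concave
  function on a convex set. Put \<open>P = sqrt \<lambda> a\<close>, so that \<open>P\<^sup>T P\<close> is the given MLE and the map is
  \<open>g \<mapsto> (P g)\<^sup>T (P g)\<close>. Its values are MLEs because \<open>P g\<close> has the same determinant and the same product
  with \<open>Y\<close> as \<open>P\<close>.

  Surjectivity (\<open>factor_eq_of_MLE\<close>): let \<open>b\<^sup>T b\<close> be an MLE. Multiplying \<open>b\<close> by a diagonal matrix of signs
  in \<open>A\<close> does not change \<open>b\<^sup>T b\<close> and makes the diagonals of \<open>b\<close> and \<open>P\<close> agree in sign. The midpoint of \<open>b\<close>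
  and \<open>P\<close> lies in \<open>A\<close>, and its likelihood exceeds the maximum unless \<open>b Y = P Y\<close>, by the parallelogram
  law and the inequality of arithmetic and geometric means. Hence \<open>b Y = P Y\<close>; as the two likelihoods
  are equal, also \<open>det b = det P\<close>, and \<open>g = P\<^sup>-\<^sup>1 b\<close> is a preimage.

  Injectivity (\<open>orthogonal_fixing_MLE\<close>): if \<open>g\<close> and \<open>g'\<close> have the same image, then \<open>P g = h P g'\<close>
  with \<open>h \<in> A\<close> orthogonal and fixing \<open>P Y\<close>. As \<open>h\<close> and its transpose are both upper triangular,
  \<open>h\<close> is diagonal with entries \<open>\<plusminus>1\<close>. If some entry were \<open>-1\<close>, the corresponding rows of \<open>P Y\<close> would
  vanish, and doubling these rows of \<open>P\<close> would increase the likelihood.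
\<close>

section \<open>The coloured matrices\<close>

lemma ordered_dag_no_loop: "ordered_dag E \<Longrightarrow> (i, i) \<notin> E"
  unfolding ordered_dag_def by blast

lemma RDAG_A_zero:
  assumes "a \<in> RDAG_A E c" "i \<noteq> j" "(j, i) \<notin> E"
  shows "a $ i $ j = 0"
proof -
  have "\<forall>i j. i \<noteq> j \<longrightarrow> (j, i) \<notin> E \<longrightarrow> a $ i $ j = 0"
    using assms(1) unfolding RDAG_A_def mem_Collect_eq by (elim conjE)
  with assms(2,3) show ?thesis
    by simp
qed

lemma RDAG_A_cong:
  assumes "a \<in> RDAG_A E c" "i = j \<or> (j, i) \<in> E" "k = l \<or> (l, k) \<in> E" "c i j = c k l"
  shows "a $ i $ j = a $ k $ l"
proof -
  have "\<forall>i j k l. i = j \<or> (j, i) \<in> E \<longrightarrow> k = l \<or> (l, k) \<in> E \<longrightarrow> c i j = c k l \<longrightarrow>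
      a $ i $ j = a $ k $ l"
    using assms(1) unfolding RDAG_A_def mem_Collect_eq by (elim conjE)
  from this[rule_format, OF assms(2-4)] show ?thesis .
qed

lemma RDAG_A_upper_triangular:
  assumes "ordered_dag E" "a \<in> RDAG_A E c" "j < i"
  shows "a $ i $ j = 0"
proof -
  have "(j, i) \<notin> E"
    using assms(1,3) unfolding ordered_dag_def by (meson order.asym)
  then show ?thesis
    using RDAG_A_zero[OF assms(2)] assms(3) by simp
qed

lemma RDAG_A_det:
  assumes "ordered_dag E" "a \<in> RDAG_A E c"
  shows "det a = (\<Prod>i\<in>UNIV. a $ i $ i)"
  using RDAG_A_upper_triangular[OF assms] by (intro det_upperdiagonal)

lemma RDAG_A_det_nonzero: "a \<in> RDAG_A E c \<Longrightarrow> det a \<noteq> 0"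
  by (simp add: RDAG_A_def invertible_det_nz)

lemma RDAG_A_diag_nonzero:
  assumes "ordered_dag E" "a \<in> RDAG_A E c"
  shows "a $ i $ i \<noteq> 0"
  using RDAG_A_det[OF assms] RDAG_A_det_nonzero[OF assms(2)] by simp

lemma RDAG_A_diag_cong:
  assumes "a \<in> RDAG_A E c" "c i i = c j j"
  shows "a $ i $ i = a $ j $ j"
  using RDAG_A_cong[OF assms(1) _ _ assms(2)] by simp

lemma RDAG_A_linear_combination:
  assumes "ordered_dag E" "a \<in> RDAG_A E c" "b \<in> RDAG_A E c"
    and "\<And>i. s * a $ i $ i + t * b $ i $ i \<noteq> 0"
  shows "s *\<^sub>R a + t *\<^sub>R b \<in> RDAG_A E c"
proof -
  let ?e = "s *\<^sub>R a + t *\<^sub>R b"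
  have "det ?e = (\<Prod>i\<in>UNIV. ?e $ i $ i)"
    using RDAG_A_upper_triangular[OF assms(1,2)] RDAG_A_upper_triangular[OF assms(1,3)]
    by (intro det_upperdiagonal) simp
  then have inv: "invertible ?e"
    using assms(4) by (simp add: invertible_det_nz)
  show ?thesis
    unfolding RDAG_A_def
  proof (intro CollectI conjI allI impI)
    show "?e $ i $ j = ?e $ k $ l"
      if "i = j \<or> (j, i) \<in> E" "k = l \<or> (l, k) \<in> E" "c i j = c k l" for i j k l
      using RDAG_A_cong[OF assms(2) that] RDAG_A_cong[OF assms(3) that] by simp
    show "?e $ i $ j = 0" if "i \<noteq> j" "(j, i) \<notin> E" for i j
      using RDAG_A_zero[OF assms(2) that] RDAG_A_zero[OF assms(3) that] by simp
  qed (rule inv)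
qed

lemma compatible_vertex_edge:
  assumes "compatible E c" "(j, i) \<in> E"
  shows "c k k \<noteq> c i j"
  using assms unfolding compatible_def by blast

lemma compatible_edge_edge:
  assumes "compatible E c" "(j, i) \<in> E" "(l, k) \<in> E" "c i j = c k l"
  shows "c i i = c k k"
  using assms unfolding compatible_def by blast

lemma RDAG_A_I:
  assumes "ordered_dag E" "compatible E c"
    and "\<And>i j. i \<noteq> j \<Longrightarrow> (j, i) \<notin> E \<Longrightarrow> b $ i $ j = 0"
    and "\<And>i. b $ i $ i \<noteq> 0"
    and "\<And>i j. c i i = c j j \<Longrightarrow> b $ i $ i = b $ j $ j"
    and "\<And>i j k l. (j, i) \<in> E \<Longrightarrow> (l, k) \<in> E \<Longrightarrow> c i j = c k l \<Longrightarrow> b $ i $ j = b $ k $ l"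
  shows "b \<in> RDAG_A E c"
proof -
  have "b $ i $ j = 0" if "j < i" for i j
    using assms(1,3) that unfolding ordered_dag_def by (metis order.asym order.irrefl)
  then have "det b = (\<Prod>i\<in>UNIV. b $ i $ i)"
    by (intro det_upperdiagonal)
  then have "invertible b"
    using assms(4) by (simp add: invertible_det_nz)
  moreover have "b $ i $ j = b $ k $ l"
    if "i = j \<or> (j, i) \<in> E" "k = l \<or> (l, k) \<in> E" "c i j = c k l" for i j k l
    using that assms(5,6) compatible_vertex_edge[OF assms(2)] by metis
  ultimately show ?thesis
    using assms(3) unfolding RDAG_A_def by blast
qed

lemma matrix_group_mult: "matrix_group A \<Longrightarrow> a \<in> A \<Longrightarrow> b \<in> A \<Longrightarrow> a ** b \<in> A"
  unfolding matrix_group_def using monoid.m_closed[OF group.is_monoid] by fastforce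

lemma matrix_group_one: "matrix_group A \<Longrightarrow> mat 1 \<in> A"
  unfolding matrix_group_def using monoid.one_closed[OF group.is_monoid] by fastforce

lemma matrix_group_inverse:
  assumes "matrix_group A" "a \<in> A"
  obtains b where "b \<in> A" "b ** a = mat 1" "a ** b = mat 1"
proof -
  obtain b where "b \<in> A" "b ** a = mat 1"
    using group.l_inv_ex[OF assms(1)[unfolded matrix_group_def]] assms(2) by auto
  then show ?thesis
    using that matrix_left_right_inverse by blast
qed

section \<open>The model and the likelihood in terms of triangular factors\<close>

lemma matrix_inv_eq:
  fixes A B :: "real^'n^'n"
  assumes "A ** B = mat 1"
  shows "matrix_inv A = B"
proof -
  have BA: "B ** A = mat 1"
    using assms matrix_left_right_inverse by blast
  have "A ** matrix_inv A = mat 1 \<and> matrix_inv A ** A = mat 1"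
    unfolding matrix_inv_def
    by (rule someI[where P = "\<lambda>A'. A ** A' = mat 1 \<and> A' ** A = mat 1", OF conjI[OF assms BA]])
  then have "matrix_inv A = (B ** A) ** matrix_inv A" "B ** (A ** matrix_inv A) = B"
    using BA by simp_all
  then show ?thesis
    by (simp add: matrix_mul_assoc)
qed

lemma matrix_linear_combination_mult:
  fixes A B :: "real^'n^'m" and X :: "real^'k^'n"
  shows "(s *\<^sub>R A + t *\<^sub>R B) ** X = s *\<^sub>R (A ** X) + t *\<^sub>R (B ** X)"
  by (simp add: vec_eq_iff matrix_matrix_mult_def sum.distrib sum_distrib_left
      distrib_right mult.assoc)

lemma diagonal_matrix_mult:
  fixes X :: "real^'n^'m"
  shows "(\<chi> i j. if i = j then d i else 0) ** X = (\<chi> i j. d i * X $ i $ j)"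
  by (simp add: vec_eq_iff matrix_matrix_mult_def if_distrib if_distribR cong: if_cong)

lemma matrix_inv_diagonal:
  fixes W :: "real^'n^'n"
  assumes "\<And>i j. i \<noteq> j \<Longrightarrow> W $ i $ j = 0" "\<And>i. W $ i $ i \<noteq> 0"
  shows "matrix_inv W = (\<chi> i j. if i = j then inverse (W $ i $ i) else 0)"
proof (rule matrix_inv_eq)
  have "W = (\<chi> i j. if i = j then W $ i $ i else 0)"
    using assms(1) by (simp add: vec_eq_iff)
  then have "W ** X = (\<chi> i j. W $ i $ i * X $ i $ j)" for X :: "real^'n^'n"
    using diagonal_matrix_mult[of "\<lambda>i. W $ i $ i" X] by simp
  then show "W ** (\<chi> i j. if i = j then inverse (W $ i $ i) else 0) = mat 1"
    using assms(2) by (simp add: vec_eq_iff mat_def)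
qed

lemma transpose_mult_diagonal_mult:
  fixes L :: "real^'n^'m"
  shows "transpose L ** (\<chi> i j. if i = j then (d i)\<^sup>2 else 0) ** L =
    transpose (\<chi> i j. d i * L $ i $ j) ** (\<chi> i j. d i * L $ i $ j)"
  unfolding matrix_mul_assoc[symmetric] diagonal_matrix_mult
  by (simp add: vec_eq_iff matrix_matrix_mult_def transpose_def power2_eq_square mult_ac)

lemma RDAG_model_eq:
  assumes "ordered_dag E" "compatible E c"
  shows "RDAG_model E c = {transpose b ** b |b. b \<in> RDAG_A E c}"
proof (intro equalityI subsetI)
  fix \<Psi> assume "\<Psi> \<in> RDAG_model E c"
  then obtain \<Lambda> \<Omega> where
    \<Psi>: "\<Psi> = transpose (mat 1 - \<Lambda>) ** matrix_inv \<Omega> ** (mat 1 - \<Lambda>)"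
    and model: "\<forall>i j. (j, i) \<notin> E \<longrightarrow> \<Lambda> $ i $ j = 0"
      "\<forall>i j k l. (j, i) \<in> E \<longrightarrow> (l, k) \<in> E \<longrightarrow> c i j = c k l \<longrightarrow> \<Lambda> $ i $ j = \<Lambda> $ k $ l"
      "\<forall>i j. i \<noteq> j \<longrightarrow> \<Omega> $ i $ j = 0"
      "\<forall>i. \<Omega> $ i $ i > 0"
      "\<forall>i j. c i i = c j j \<longrightarrow> \<Omega> $ i $ i = \<Omega> $ j $ j"
    unfolding RDAG_model_def by blast
  note \<Lambda>0 = model(1)[rule_format] and \<Lambda>c = model(2)[rule_format]
    and \<Omega>0 = model(3)[rule_format] and \<Omega>pos = model(4)[rule_format] and \<Omega>c = model(5)[rule_format]
  define d where "d i = 1 / sqrt (\<Omega> $ i $ i)" for i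
  define b where "b = (\<chi> i j. d i * (mat 1 - \<Lambda>) $ i $ j)"
  have d: "d i \<noteq> 0" "(d i)\<^sup>2 = inverse (\<Omega> $ i $ i)" for i
    using \<Omega>pos[of i] by (simp_all add: d_def power_divide inverse_eq_divide)
  have "matrix_inv \<Omega> = (\<chi> i j. if i = j then (d i)\<^sup>2 else 0)"
    unfolding d using \<Omega>0 \<Omega>pos by (intro matrix_inv_diagonal) (auto simp: less_imp_neq[symmetric])
  then have "\<Psi> = transpose b ** b"
    unfolding \<Psi> b_def by (simp only: transpose_mult_diagonal_mult)
  moreover have "b \<in> RDAG_A E c"
  proof (rule RDAG_A_I[OF assms])
    note loop = ordered_dag_no_loop[OF assms(1)]
    show "b $ i $ i \<noteq> 0" for i
      using d \<Lambda>0[OF loop] by (simp add: b_def mat_def)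
    show "b $ i $ i = b $ j $ j" if "c i i = c j j" for i j
      using \<Omega>c[OF that] \<Lambda>0[OF loop] by (simp add: b_def mat_def d_def)
    show "b $ i $ j = b $ k $ l" if "(j, i) \<in> E" "(l, k) \<in> E" "c i j = c k l" for i j k l
    proof -
      have "d i = d k"
        using \<Omega>c[OF compatible_edge_edge[OF assms(2) that]] by (simp add: d_def)
      moreover have "i \<noteq> j" "k \<noteq> l"
        using that loop by auto
      ultimately show ?thesis
        using \<Lambda>c[OF that] by (simp add: b_def mat_def)
    qed
  qed (simp add: b_def mat_def \<Lambda>0)
  ultimately show "\<Psi> \<in> {transpose b ** b |b. b \<in> RDAG_A E c}"
    by blast
next
  fix \<Psi> assume "\<Psi> \<in> {transpose b ** b |b. b \<in> RDAG_A E c}"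
  then obtain b where \<Psi>: "\<Psi> = transpose b ** b" and b: "b \<in> RDAG_A E c"
    by blast
  note b_nonzero = RDAG_A_diag_nonzero[OF assms(1) b]
  define \<Lambda> where "\<Lambda> = (\<chi> i j. if i = j then 0 else - (b $ i $ j / b $ i $ i))"
  define \<Omega> where "\<Omega> = (\<chi> i j. if i = j then inverse ((b $ i $ i)\<^sup>2) else 0)"
  have "matrix_inv \<Omega> = (\<chi> i j. if i = j then inverse (\<Omega> $ i $ i) else 0)"
    using b_nonzero by (intro matrix_inv_diagonal) (simp_all add: \<Omega>_def)
  also have "\<dots> = (\<chi> i j. if i = j then (b $ i $ i)\<^sup>2 else 0)"
    by (simp add: \<Omega>_def vec_eq_iff)
  finally have inv: "matrix_inv \<Omega> = \<dots>" .
  have "(\<chi> i j. b $ i $ i * (mat 1 - \<Lambda>) $ i $ j) = b"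
    using b_nonzero by (simp add: \<Lambda>_def mat_def vec_eq_iff)
  then have "\<Psi> = transpose (mat 1 - \<Lambda>) ** matrix_inv \<Omega> ** (mat 1 - \<Lambda>)"
    unfolding \<Psi> inv transpose_mult_diagonal_mult by simp
  moreover have "\<forall>i j. (j, i) \<notin> E \<longrightarrow> \<Lambda> $ i $ j = 0"
    using RDAG_A_zero[OF b] by (simp add: \<Lambda>_def)
  moreover have "\<forall>i j k l. (j, i) \<in> E \<longrightarrow> (l, k) \<in> E \<longrightarrow> c i j = c k l \<longrightarrow>
      \<Lambda> $ i $ j = \<Lambda> $ k $ l"
  proof (intro allI impI)
    fix i j k l assume e: "(j, i) \<in> E" "(l, k) \<in> E" "c i j = c k l"
    then have "i \<noteq> j" "k \<noteq> l"
      using ordered_dag_no_loop[OF assms(1)] by metis+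
    moreover have "b $ i $ j = b $ k $ l"
      using RDAG_A_cong[OF b] e by blast
    moreover have "b $ i $ i = b $ k $ k"
      using RDAG_A_diag_cong[OF b compatible_edge_edge[OF assms(2) e]] .
    ultimately show "\<Lambda> $ i $ j = \<Lambda> $ k $ l"
      by (simp add: \<Lambda>_def)
  qed
  moreover have "\<forall>i. \<Omega> $ i $ i > 0"
    using b_nonzero by (simp add: \<Omega>_def)
  moreover have "\<forall>i j. i \<noteq> j \<longrightarrow> \<Omega> $ i $ j = 0"
    by (simp add: \<Omega>_def)
  moreover have "\<Omega> $ i $ i = \<Omega> $ j $ j" if "c i i = c j j" for i j
    using RDAG_A_diag_cong[OF b that] by (simp add: \<Omega>_def)
  ultimately show "\<Psi> \<in> RDAG_model E c"
    unfolding RDAG_model_def by blast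
qed

lemma trace_gram_sample_cov:
  fixes Y :: "real^'n^'m" and b :: "real^'m^'m"
  shows "trace ((transpose b ** b) ** sample_cov Y) = (norm (b ** Y))\<^sup>2 / real CARD('n)"
proof -
  have gram: "trace (X ** transpose X) = (norm X)\<^sup>2" for X :: "real^'n^'m"
    by (simp add: power2_norm_eq_inner inner_vec_def trace_def matrix_matrix_mult_def transpose_def)
  have "trace ((transpose b ** b) ** sample_cov Y) =
      trace ((transpose b ** b) ** (Y ** transpose Y)) / real CARD('n)"
    by (simp add: sample_cov_def matrix_scalar_ac trace_def sum_divide_distrib
        flip: scalar_matrix_assoc)
  also have "(transpose b ** b) ** (Y ** transpose Y) = transpose b ** (b ** Y ** transpose Y)"
    by (simp add: matrix_mul_assoc)
  also have "trace \<dots> = trace ((b ** Y ** transpose Y) ** transpose b)"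
    by (rule trace_mul_sym)
  also have "(b ** Y ** transpose Y) ** transpose b = (b ** Y) ** transpose (b ** Y)"
    by (simp add: matrix_mul_assoc matrix_transpose_mul)
  finally show ?thesis
    by (simp only: gram)
qed

lemma log_likelihood_gram:
  fixes Y :: "real^'n^'m" and b :: "real^'m^'m"
  shows "log_likelihood Y (transpose b ** b) =
    ln ((det b)\<^sup>2) - (norm (b ** Y))\<^sup>2 / real CARD('n)"
  by (simp add: log_likelihood_def trace_gram_sample_cov det_mul power2_eq_square)

lemma gram_in_MLEs_iff:
  assumes "ordered_dag E" "compatible E c" "b \<in> RDAG_A E c"
  shows "transpose b ** b \<in> MLEs (RDAG_model E c) Y \<longleftrightarrow>
    (\<forall>d\<in>RDAG_A E c. log_likelihood Y (transpose d ** d) \<le> log_likelihood Y (transpose b ** b))"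
  unfolding MLEs_def RDAG_model_eq[OF assms(1,2)] is_arg_max_def
  using assms(3) by (auto simp: not_less)

section \<open>Comparing two maximisers\<close>

lemma midpoint_sq_ge:
  fixes x y :: real
  shows "x * y \<le> ((x + y) / 2)\<^sup>2"
  using zero_le_power2[of "x - y"] by (simp add: power2_eq_square field_simps)

lemma parallelogram_midpoint:
  fixes u v :: "'a::real_inner"
  shows "(norm ((1/2) *\<^sub>R (u + v)))\<^sup>2 = ((norm u)\<^sup>2 + (norm v)\<^sup>2) / 2 - (norm (u - v))\<^sup>2 / 4"
proof -
  have "(norm (u + v))\<^sup>2 + (norm (u - v))\<^sup>2 = 2 * (norm u)\<^sup>2 + 2 * (norm v)\<^sup>2"
    by (simp add: power2_norm_eq_inner inner_add inner_diff inner_commute)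
  moreover have "(norm ((1/2) *\<^sub>R (u + v)))\<^sup>2 = (norm (u + v))\<^sup>2 / 4"
    unfolding norm_scaleR by (simp add: power_divide)
  ultimately show ?thesis
    by (simp add: field_simps)
qed

text \<open>
  Strict concavity in the direction of \<open>b Y\<close>: two factors of MLEs whose diagonals agree in sign have the
  same product with \<open>Y\<close> and the same determinant.
\<close>
lemma factor_eq_of_MLE:
  fixes Y :: "real^'n^('m::{finite,wellorder})"
  assumes E: "ordered_dag E" and comp: "compatible E c"
    and b: "b \<in> RDAG_A E c" and p: "p \<in> RDAG_A E c"
    and bM: "transpose b ** b \<in> MLEs (RDAG_model E c) Y"
    and pM: "transpose p ** p \<in> MLEs (RDAG_model E c) Y"
    and same_sign: "\<And>i. b $ i $ i * p $ i $ i > 0"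
  shows "b ** Y = p ** Y" "det b = det p"
proof -
  let ?l = "\<lambda>d. log_likelihood Y (transpose d ** d)"
  let ?n = "real CARD('n)"
  define N where "N d = (norm (d ** Y))\<^sup>2 / ?n"
    for d :: "real^('m::{finite,wellorder})^('m::{finite,wellorder})"
  define D where "D = (norm (b ** Y - p ** Y))\<^sup>2 / ?n"
  define e where "e = (1/2) *\<^sub>R b + (1/2) *\<^sub>R p"
  have diag_sq: "0 < b $ i $ i * p $ i $ i" "b $ i $ i * p $ i $ i \<le> (e $ i $ i)\<^sup>2" for i
    using same_sign[of i] midpoint_sq_ge[of "b $ i $ i" "p $ i $ i"]
    by (simp_all add: e_def add_divide_distrib)
  have e: "e \<in> RDAG_A E c"
    unfolding e_def
  proof (rule RDAG_A_linear_combination[OF E b p])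
    show "1/2 * b $ i $ i + 1/2 * p $ i $ i \<noteq> 0" for i
      using diag_sq[of i] by (auto simp: e_def)
  qed
  have eq: "?l b = ?l p" and le: "?l e \<le> ?l b"
    using bM pM e b p gram_in_MLEs_iff[OF E comp] by (auto intro: antisym)
  have det_bp: "det b * det p = (\<Prod>i\<in>UNIV. b $ i $ i * p $ i $ i)"
    by (simp add: RDAG_A_det[OF E b] RDAG_A_det[OF E p] prod.distrib)
  then have pos: "0 < det b * det p"
    using diag_sq(1) by (simp add: prod_pos)
  have "det b * det p \<le> (\<Prod>i\<in>UNIV. (e $ i $ i)\<^sup>2)"
    unfolding det_bp using diag_sq by (intro prod_mono) (simp add: less_imp_le)
  also have "\<dots> = (det e)\<^sup>2"
    by (simp add: RDAG_A_det[OF E e] prod_power_distrib)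
  finally have "ln (det b * det p) \<le> ln ((det e)\<^sup>2)"
    using pos by (intro ln_mono)
  moreover have "2 * ln (det b * det p) = ln ((det b)\<^sup>2 * (det p)\<^sup>2)"
    using ln_realpow[of "det b * det p" 2] pos by (simp add: power_mult_distrib)
  moreover have "ln ((det b)\<^sup>2 * (det p)\<^sup>2) = ln ((det b)\<^sup>2) + ln ((det p)\<^sup>2)"
    using RDAG_A_det_nonzero[OF b] RDAG_A_det_nonzero[OF p] by (simp add: ln_mult)
  ultimately have ln_ge: "ln ((det b)\<^sup>2) + ln ((det p)\<^sup>2) \<le> 2 * ln ((det e)\<^sup>2)"
    by linarith
  have "e ** Y = (1/2) *\<^sub>R (b ** Y + p ** Y)"
    unfolding e_def matrix_linear_combination_mult by (simp add: scaleR_add_right)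
  then have "(norm (e ** Y))\<^sup>2 =
      ((norm (b ** Y))\<^sup>2 + (norm (p ** Y))\<^sup>2) / 2 - (norm (b ** Y - p ** Y))\<^sup>2 / 4"
    by (simp only: parallelogram_midpoint)
  then have N: "4 * N e = 2 * N b + 2 * N p - D"
    by (simp add: N_def D_def add_divide_distrib diff_divide_distrib)
  have l: "?l d = ln ((det d)\<^sup>2) - N d" for d
    by (simp add: log_likelihood_gram N_def)
  have "D \<le> 0"
    using eq le ln_ge N unfolding l by linarith
  then have "(norm (b ** Y - p ** Y))\<^sup>2 / ?n \<le> 0"
    by (simp only: D_def)
  then show bY: "b ** Y = p ** Y"
    by (simp add: divide_le_0_iff)
  have "ln ((det b)\<^sup>2) = ln ((det p)\<^sup>2)"
    using eq by (simp add: log_likelihood_gram bY)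
  then have "(det b)\<^sup>2 = (det p)\<^sup>2"
    using RDAG_A_det_nonzero[OF b] RDAG_A_det_nonzero[OF p] by simp
  then show "det b = det p"
    using pos by (auto simp: power2_eq_iff zero_less_mult_iff)
qed

text \<open>
  Rows of \<open>p\<close> that \<open>Y\<close> annihilates can be rescaled without changing \<open>p Y\<close>. If a nontrivial orthogonal
  \<open>h\<close> in \<open>A\<close> fixed \<open>p Y\<close>, it would single out such rows, and enlarging them would increase the
  determinant and hence the likelihood.
\<close>
lemma orthogonal_fixing_MLE:
  fixes Y :: "real^'n^('m::{finite,wellorder})"
  assumes E: "ordered_dag E" and comp: "compatible E c" and grp: "matrix_group (RDAG_A E c)"
    and p: "p \<in> RDAG_A E c" and pM: "transpose p ** p \<in> MLEs (RDAG_model E c) Y"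
    and h: "h \<in> RDAG_A E c" "transpose h ** h = mat 1" "h ** (p ** Y) = p ** Y"
  shows "h = mat 1"
proof -
  \<comment> \<open>The transpose of \<open>h\<close> is its inverse and therefore again in the group.\<close>
  obtain h' where h': "h' \<in> RDAG_A E c" "h ** h' = mat 1"
    using matrix_group_inverse[OF grp h(1)] by blast
  have "h' = transpose h ** h ** h'"
    by (simp add: h(2))
  also have "\<dots> = transpose h"
    by (simp add: h'(2) flip: matrix_mul_assoc)
  finally have "transpose h \<in> RDAG_A E c"
    using h'(1) by simp
  from RDAG_A_upper_triangular[OF E h(1)] RDAG_A_upper_triangular[OF E this]
  have off: "h $ i $ j = 0" if "i \<noteq> j" for i j
    using that by (cases i j rule: linorder_cases) (auto simp: transpose_def)
  have diag: "h $ i $ i = 1 \<or> h $ i $ i = -1" for i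
  proof -
    have "(transpose h ** h) $ i $ i = (\<Sum>k\<in>UNIV. h $ k $ i * h $ k $ i)"
      by (simp add: matrix_matrix_mult_def transpose_def)
    also have "\<dots> = (\<Sum>k\<in>{i}. h $ k $ i * h $ k $ i)"
      using off by (intro sum.mono_neutral_right) auto
    finally show ?thesis
      using h(2) by (simp add: mat_def square_eq_1_iff)
  qed
  \<comment> \<open>\<open>k\<close> doubles the rows with \<open>h\<close>-entry \<open>-1\<close> and keeps the others.\<close>
  define k where "k = (3/2) *\<^sub>R mat 1 + (-1/2) *\<^sub>R h"
  have kii: "k $ i $ i = (if h $ i $ i = 1 then 1 else 2)" for i
    using diag[of i] by (auto simp: k_def mat_def)
  have k: "k \<in> RDAG_A E c"
    unfolding k_def
  proof (rule RDAG_A_linear_combination[OF E matrix_group_one[OF grp] h(1)])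
    show "3/2 * (mat 1 :: real^('m::{finite,wellorder})^('m::{finite,wellorder})) $ i $ i
        + -1/2 * h $ i $ i \<noteq> 0" for i
      using diag[of i] by (auto simp: mat_def)
  qed
  have "k ** (p ** Y) = (3/2) *\<^sub>R (p ** Y) + (-1/2) *\<^sub>R (h ** (p ** Y))"
    unfolding k_def matrix_linear_combination_mult by simp
  also have "\<dots> = p ** Y"
    by (simp add: h(3) flip: scaleR_left_diff_distrib)
  finally have kY: "(k ** p) ** Y = p ** Y"
    by (simp add: matrix_mul_assoc)
  have "log_likelihood Y (transpose (k ** p) ** (k ** p)) \<le> log_likelihood Y (transpose p ** p)"
    using pM matrix_group_mult[OF grp k p] gram_in_MLEs_iff[OF E comp p] by blast
  then have "ln ((det (k ** p))\<^sup>2) \<le> ln ((det p)\<^sup>2)"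
    unfolding log_likelihood_gram kY by simp
  then have "(det k)\<^sup>2 * (det p)\<^sup>2 \<le> (det p)\<^sup>2"
    using RDAG_A_det_nonzero[OF k] RDAG_A_det_nonzero[OF p] by (simp add: det_mul power_mult_distrib)
  then have "(det k)\<^sup>2 \<le> 1"
    using RDAG_A_det_nonzero[OF p] by (simp add: mult_le_cancel_right1)
  then have det_k: "det k \<le> 1"
    by (simp add: power_le_one_iff abs_square_le_1)
  have "h $ i $ i = 1" for i
  proof (rule ccontr)
    assume "h $ i $ i \<noteq> 1"
    then have "1 < k $ i $ i"
      by (simp add: kii)
    also have "k $ i $ i = (\<Prod>j\<in>{i}. k $ j $ j)"
      by simp
    also have "\<dots> \<le> (\<Prod>j\<in>UNIV. k $ j $ j)"
      by (intro prod_mono2) (auto simp: kii)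
    finally show False
      using det_k RDAG_A_det[OF E k] by simp
  qed
  then show ?thesis
    using off by (simp add: vec_eq_iff mat_def)
qed

text \<open>The sign changes in \<open>A\<close> allow the diagonals of two elements of \<open>A\<close> to be aligned.\<close>
lemma align_signs:
  fixes b p :: "real^('m::{finite,wellorder})^('m::{finite,wellorder})"
  assumes E: "ordered_dag E" and comp: "compatible E c" and grp: "matrix_group (RDAG_A E c)"
    and b: "b \<in> RDAG_A E c" and p: "p \<in> RDAG_A E c"
  obtains b' where "b' \<in> RDAG_A E c" "transpose b' ** b' = transpose b ** b"
    "\<And>i. b' $ i $ i * p $ i $ i > 0"
proof -
  define d where "d i = sgn (b $ i $ i * p $ i $ i)" for i
  note nonzero = RDAG_A_diag_nonzero[OF E b] RDAG_A_diag_nonzero[OF E p]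
  define t where "t = (\<chi> i j. if i = j then d i else 0)"
  have t: "t \<in> RDAG_A E c"
  proof (rule RDAG_A_I[OF E comp])
    show "t $ i $ i = t $ j $ j" if "c i i = c j j" for i j
      using RDAG_A_diag_cong[OF b that] RDAG_A_diag_cong[OF p that] by (simp add: t_def d_def)
    show "t $ i $ j = t $ k $ l" if "(j, i) \<in> E" "(l, k) \<in> E" "c i j = c k l" for i j k l
      using that ordered_dag_no_loop[OF E] by (auto simp: t_def)
  qed (use nonzero in \<open>auto simp: t_def d_def sgn_zero_iff\<close>)
  have "transpose t ** t = mat 1"
  proof -
    have "transpose t = t"
      by (auto simp: t_def transpose_def vec_eq_iff)
    moreover have "d i * d i = 1" for i
      using nonzero by (simp add: d_def sgn_if)
    then have "t ** t = mat 1"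
      unfolding t_def diagonal_matrix_mult by (simp add: vec_eq_iff mat_def)
    ultimately show ?thesis
      by simp
  qed
  then have "transpose b ** (transpose t ** t) ** b = transpose b ** b"
    by simp
  then have "transpose (t ** b) ** (t ** b) = transpose b ** b"
    by (simp add: matrix_transpose_mul matrix_mul_assoc)
  moreover have "(t ** b) $ i $ i * p $ i $ i > 0" for i
    using nonzero by (simp add: t_def d_def diagonal_matrix_mult sgn_if mult.assoc zero_less_mult_iff
        mult_less_0_iff not_less order_less_le)
  ultimately show thesis
    using that matrix_group_mult[OF grp t b] by blast
qed

section \<open>The parametrisation of the maximisers\<close>

lemma bij_betw_stabilizer_MLEs:
  fixes Y :: "real^'n^('m::{finite,wellorder})"
  assumes E: "ordered_dag E" and comp: "compatible E c" and grp: "matrix_group (RDAG_A E c)"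
    and p: "p \<in> RDAG_A E c" and pM: "transpose p ** p \<in> MLEs (RDAG_model E c) Y"
  shows "bij_betw (\<lambda>g. transpose (p ** g) ** (p ** g))
    (mat_stabilizer (RDAG_A_SL E c) Y) (MLEs (RDAG_model E c) Y)"
proof -
  let ?A = "RDAG_A E c" and ?S = "mat_stabilizer (RDAG_A_SL E c) Y"
  have S_iff: "g \<in> ?S \<longleftrightarrow> g \<in> ?A \<and> det g = 1 \<and> g ** Y = Y" for g
    by (auto simp: mat_stabilizer_def RDAG_A_SL_def)
  obtain p' where p': "p' \<in> ?A" "p' ** p = mat 1" "p ** p' = mat 1"
    using matrix_group_inverse[OF grp p] .
  have mem: "transpose (p ** g) ** (p ** g) \<in> MLEs (RDAG_model E c) Y" if "g \<in> ?S" for g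
  proof -
    have "g \<in> ?A" "det g = 1" "(p ** g) ** Y = p ** Y"
      using that by (simp_all add: S_iff flip: matrix_mul_assoc)
    then show ?thesis
      using pM p matrix_group_mult[OF grp p]
      by (simp add: gram_in_MLEs_iff[OF E comp] log_likelihood_gram det_mul)
  qed
  have inj: "g = g'"
    if g: "g \<in> ?S" and g': "g' \<in> ?S"
      and eq: "transpose (p ** g) ** (p ** g) = transpose (p ** g') ** (p ** g')" for g g'
  proof -
    let ?q = "p ** g'"
    have q: "?q \<in> ?A"
      using g' p matrix_group_mult[OF grp] by (simp add: S_iff)
    obtain r where r: "r \<in> ?A" "r ** ?q = mat 1" "?q ** r = mat 1"
      using matrix_group_inverse[OF grp q] .
    define h where "h = p ** g ** r"
    have hq: "h ** ?q = p ** g"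
      using r(2) by (simp add: h_def flip: matrix_mul_assoc)
    have "h \<in> ?A"
      using g p r(1) matrix_group_mult[OF grp] by (simp add: h_def S_iff)
    moreover have "transpose h ** h = mat 1"
    proof -
      have "transpose h ** h = transpose r ** (transpose (p ** g) ** (p ** g)) ** r"
        by (simp add: h_def matrix_transpose_mul matrix_mul_assoc)
      also have "\<dots> = transpose (?q ** r) ** (?q ** r)"
        unfolding eq by (simp add: matrix_transpose_mul matrix_mul_assoc)
      finally show ?thesis
        by (simp add: r(3))
    qed
    moreover have "h ** (p ** Y) = p ** Y"
    proof -
      have "?q ** Y = p ** Y" "p ** g ** Y = p ** Y"
        using g g' by (simp_all add: S_iff flip: matrix_mul_assoc)
      then show ?thesis
        by (metis hq matrix_mul_assoc)
    qed
    ultimately have "h = mat 1"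
      using orthogonal_fixing_MLE[OF E comp grp p pM] by blast
    then have "p ** g = p ** g'"
      using hq by simp
    then have "p' ** p ** g = p' ** p ** g'"
      by (simp flip: matrix_mul_assoc)
    then show ?thesis
      by (simp add: p'(2))
  qed
  have surj: "\<exists>g\<in>?S. \<Psi> = transpose (p ** g) ** (p ** g)"
    if \<Psi>: "\<Psi> \<in> MLEs (RDAG_model E c) Y" for \<Psi>
  proof -
    have "\<Psi> \<in> RDAG_model E c"
      using \<Psi> by (simp add: MLEs_def is_arg_max_def)
    then obtain b0 where b0: "b0 \<in> ?A" "\<Psi> = transpose b0 ** b0"
      unfolding RDAG_model_eq[OF E comp] by blast
    obtain b where b: "b \<in> ?A" "\<Psi> = transpose b ** b" "\<And>i. b $ i $ i * p $ i $ i > 0"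
      using align_signs[OF E comp grp b0(1) p] b0(2) by metis
    note same = factor_eq_of_MLE[OF E comp b(1) p \<Psi>[unfolded b(2)] pM b(3)]
    have "p' ** b \<in> ?A"
      using matrix_group_mult[OF grp p'(1) b(1)] .
    moreover have "det (p' ** b) = det (p' ** p)"
      by (simp only: det_mul same(2))
    moreover have "(p' ** b) ** Y = (p' ** p) ** Y"
      by (simp add: same(1) flip: matrix_mul_assoc)
    ultimately have "p' ** b \<in> ?S"
      by (simp add: S_iff p'(2))
    moreover have "p ** (p' ** b) = b"
      by (simp add: matrix_mul_assoc p'(3))
    ultimately show ?thesis
      using b(2) by metis
  qed
  show ?thesis
    unfolding bij_betw_def inj_on_def image_def using mem inj surj by blast
qed

theorem propositionB6:
  fixes E :: "('m::{finite,wellorder} \<times> 'm) set"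
    and c :: "'m \<Rightarrow> 'm \<Rightarrow> 'c"
    and Y :: "real^'n^('m::{finite,wellorder})"
    and a :: "real^('m::{finite,wellorder})^('m::{finite,wellorder})"
    and lam :: real
  assumes "ordered_dag E"
    and "compatible E c"
    and "matrix_group (RDAG_A E c)"
    and "polystable (RDAG_A_SL E c) Y"
    and "a \<in> RDAG_A_SL E c"
    and "norm (a ** Y) > 0"
    and "\<forall>Z \<in> mat_orbit (RDAG_A_SL E c) Y. norm (a ** Y) \<le> norm Z"
    and "lam > 0"
    and "\<forall>x. is_arg_min (\<lambda>x. x / real CARD('n) * (norm (a ** Y))\<^sup>2 - real CARD('m) * ln x)
                (\<lambda>x. 0 < x) x \<longleftrightarrow> x = lam"
    and "lam *\<^sub>R (transpose a ** a) \<in> MLEs (RDAG_model E c) Y"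
  shows "bij_betw (\<lambda>g. lam *\<^sub>R (transpose g ** transpose a ** a ** g))
           (mat_stabilizer (RDAG_A_SL E c) Y)
           (MLEs (RDAG_model E c) Y)"
proof -
  define p where "p = sqrt lam *\<^sub>R a"
  have a: "a \<in> RDAG_A E c"
    using assms(5) by (simp add: RDAG_A_SL_def)
  \<comment> \<open>\<open>p\<close> is a degenerate linear combination.\<close>
  have "sqrt lam *\<^sub>R a + 0 *\<^sub>R a \<in> RDAG_A E c"
    using assms(8) RDAG_A_diag_nonzero[OF assms(1) a]
    by (intro RDAG_A_linear_combination[OF assms(1) a a]) simp
  then have p: "p \<in> RDAG_A E c"
    by (simp add: p_def)
  have factor: "transpose (p ** g) ** (p ** g) = lam *\<^sub>R (transpose g ** transpose a ** a ** g)"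
    for g
    using assms(8)
    by (simp add: p_def matrix_transpose_mul transpose_scalar matrix_scalar_ac matrix_mul_assoc
        flip: scalar_matrix_assoc)
  have "transpose p ** p \<in> MLEs (RDAG_model E c) Y"
    using assms(10) factor[of "mat 1"] by simp
  from bij_betw_stabilizer_MLEs[OF assms(1-3) p this] show ?thesis
    unfolding factor .
qed

end
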